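(* Let $c:\mathbb{R}^n\times\mathbb{R}^m\to\mathbb{R}$ be Lipschitz continuous, with $c(\cdot,y)$ convex for every $y\in\mathbb{R}^m$ and $c(x,\cdot)$ concave for every $x\in\mathbb{R}^n$. Let $g:\mathbb{R}^n\to\mathbb{R}^{\hat n}$ and $h:\mathbb{R}^m\to\mathbb{R}^{\hat m}$ be continuously differentiable, let $X\subset\mathbb{R}^n$ and $Y\subset\mathbb{R}^m$ be nonempty, convex and compact, and let $\lambda_1,\lambda_2>0$. Let $\rho:\mathbb{R}\to[0,+\infty)$ be a piecewise continuous density function with $\rho(s)=0$ for all $s\notin[0,\alpha]$, where $\alpha>0$, and for $\mu>0$ let $r(t,\mu)=\int_{-\infty}^{t/\mu}\rho(s)\,ds$. Then there exists a $\tilde\mu>0$ such that for any $\mu\in(0,\tilde\mu)$ the problem $$\min_{x\in X}\max_{y\in Y} f^R(x,y,\mu):=c(x,y)+\lambda_1\sum_{i=1}^{\hat n} r(g_i(x),\mu)-\lambda_2\sum_{j=1}^{\hat m} r(h_j(y),\mu)$$ has a local saddle point.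
   Context: A density function is a nonnegative function with integral $1$, so $\int_0^\alpha\rho(s)\,ds=1$. $\mathbf{B}(z,\delta)$ is the closed ball with center $z$ and radius $\delta$. A point $(x^*,y^* )\in X\times Y$ is a local saddle point of $\min_{x\in X}\max_{y\in Y}F(x,y)$ if there is a $\delta>0$ such that $F(x^*,y)\le F(x^*,y^* )\le F(x,y^* )$ for all $x\in X\cap\mathbf{B}(x^*,\delta)$ and $y\in Y\cap\mathbf{B}(y^*,\delta)$. *)

theory Defs
  imports "HOL-Analysis.Analysis"
begin

text \<open>Locally finitely many discontinuities, with finite one-sided limits everywhere.\<close>

definition piecewise_continuous :: "(real \<Rightarrow> real) \<Rightarrow> bool" where
  "piecewise_continuous f \<longleftrightarrow>
     (\<forall>a b. finite {x \<in> {a..b}. \<not> isCont f x}) \<and>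
     (\<forall>x. (\<exists>l. (f \<longlongrightarrow> l) (at_left x)) \<and> (\<exists>l. (f \<longlongrightarrow> l) (at_right x)))"

definition density_function :: "(real \<Rightarrow> real) \<Rightarrow> bool" where
  "density_function f \<longleftrightarrow> (\<forall>s. 0 \<le> f s) \<and> (f has_integral 1) UNIV"

text \<open>Differentiable everywhere, with derivative continuous in the operator norm.\<close>

definition continuously_differentiable ::
    "('a::real_normed_vector \<Rightarrow> 'b::real_normed_vector) \<Rightarrow> bool" where
  "continuously_differentiable f \<longleftrightarrow>
     (\<exists>f' :: 'a \<Rightarrow> 'a \<Rightarrow>\<^sub>L 'b.
        (\<forall>x. (f has_derivative blinfun_apply (f' x)) (at x)) \<and> continuous_on UNIV f')"

definition local_saddle_point ::
    "'a::metric_space set \<Rightarrow> 'b::metric_space set \<Rightarrow> ('a \<Rightarrow> 'b \<Rightarrow> real) \<Rightarrow> 'a \<Rightarrow> 'b \<Rightarrow> bool" where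
  "local_saddle_point X Y F xs ys \<longleftrightarrow>
     xs \<in> X \<and> ys \<in> Y \<and>
     (\<exists>\<delta>>0. \<forall>x \<in> X \<inter> cball xs \<delta>. \<forall>y \<in> Y \<inter> cball ys \<delta>.
        F xs y \<le> F xs ys \<and> F xs ys \<le> F x ys)"

definition smoothed_step :: "(real \<Rightarrow> real) \<Rightarrow> real \<Rightarrow> real \<Rightarrow> real" where
  "smoothed_step \<rho> t \<mu> = integral {..t / \<mu>} \<rho>"

definition fR ::
    "((real^'n) \<times> (real^'m) \<Rightarrow> real) \<Rightarrow> (real^'n \<Rightarrow> real^'p::finite) \<Rightarrow> (real^'m \<Rightarrow> real^'q::finite)
      \<Rightarrow> real \<Rightarrow> real \<Rightarrow> (real \<Rightarrow> real) \<Rightarrow> real^'n \<Rightarrow> real^'m \<Rightarrow> real \<Rightarrow> real" where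
  "fR c g h l1 l2 \<rho> x y \<mu> =
     c (x, y) + l1 * (\<Sum>i\<in>UNIV. smoothed_step \<rho> (g x $ i) \<mu>)
              - l2 * (\<Sum>j\<in>UNIV. smoothed_step \<rho> (h y $ j) \<mu>)"

end

theory Submission
  imports Defs
begin

text \<open>
  The witness does not depend on \<open>\<mu>\<close>: a saddle point \<open>(x0, y0)\<close> of the convex-concave part \<open>c\<close> over
  \<open>X \<times> Y\<close> is a local saddle point of the full objective for every small \<open>\<mu>\<close>. The reason is that the
  smoothed step \<open>t \<mapsto> r(t, \<mu>)\<close> takes its least value, zero, on \<open>t \<le> 0\<close> and equals one on
  \<open>t \<ge> \<alpha> \<mu>\<close>. Hence a summand \<open>r(g\<^sub>i(x), \<mu>)\<close> with \<open>g\<^sub>i(x0) \<le> 0\<close> has a global minimum at \<open>x0\<close>, and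
  one with \<open>g\<^sub>i(x0) > 0\<close> is constant near \<open>x0\<close> as soon as \<open>\<alpha> \<mu> < g\<^sub>i(x0)\<close>
  (lemma \<open>smoothed_step_local_min\<close>). So the penalty in \<open>x\<close> has a local minimum at \<open>x0\<close>,
  which adds to the minimum of \<open>c(\<cdot>, y0)\<close>; the penalty in \<open>y\<close> enters with the
  opposite sign and adds to the maximum of \<open>c(x0, \<cdot>)\<close> in the same way.

  The existence of \<open>(x0, y0)\<close> is von Neumann's minimax theorem (\<open>convex_concave_saddle_point\<close>). It is
  derived from Ky Fan's inequality (\<open>ky_fan_inequality\<close>), and that in turn from Brouwer's fixed point
  theorem: a quadratic proximal term makes best responses unique, hence continuous, and at a fixed
  point the proximal term vanishes to second order and can be dropped by convexity.
\<close>

section \<open>Saddle points of convex-concave functions\<close>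

text \<open>The graph of the minimiser map is cut
  out of the closed set \<open>S \<times> K\<close> by weak inequalities between continuous functions (uniqueness
  ensures that these single out the graph and nothing more), and a map into a compact
  set with closed graph is continuous.\<close>

lemma continuous_on_unique_minimiser:
  fixes \<psi> :: "'a::euclidean_space \<Rightarrow> 'b::euclidean_space \<Rightarrow> real"
  assumes "closed S" "compact K"
    and cont: "continuous_on (S \<times> K) (\<lambda>(p, q). \<psi> p q)"
    and min: "\<And>p. p \<in> S \<Longrightarrow> f p \<in> K \<and> (\<forall>r\<in>K. \<psi> p (f p) \<le> \<psi> p r)"
    and uniq: "\<And>p q. \<lbrakk>p \<in> S; q \<in> K; \<forall>r\<in>K. \<psi> p q \<le> \<psi> p r\<rbrakk> \<Longrightarrow> q = f p"
  shows "continuous_on S f"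
proof (rule continuous_from_closed_graph[OF \<open>compact K\<close>])
  show "f \<in> S \<rightarrow> K" using min by auto
  have cl: "closed (S \<times> K)"
    using assms(1) compact_imp_closed[OF assms(2)] by (rule closed_Times)
  have "closed {z \<in> S \<times> K. \<psi> (fst z) (snd z) \<le> \<psi> (fst z) r}" if "r \<in> K" for r
  proof (rule continuous_on_closed_Collect_le[OF _ _ cl])
    show "continuous_on (S \<times> K) (\<lambda>z. \<psi> (fst z) (snd z))"
      using cont by (simp add: case_prod_unfold)
    have "continuous_on (S \<times> K) (\<lambda>z. (\<lambda>(p, q). \<psi> p q) (fst z, r))"
      by (rule continuous_on_compose2[OF cont]) (use that in \<open>auto intro!: continuous_intros\<close>)
    then show "continuous_on (S \<times> K) (\<lambda>z. \<psi> (fst z) r)" by simp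
  qed
  then have "closed ((S \<times> K) \<inter> (\<Inter>r\<in>K. {z \<in> S \<times> K. \<psi> (fst z) (snd z) \<le> \<psi> (fst z) r}))"
    using cl by (intro closed_Int closed_INT) auto
  moreover have "(\<lambda>p. (p, f p)) ` S =
      (S \<times> K) \<inter> (\<Inter>r\<in>K. {z \<in> S \<times> K. \<psi> (fst z) (snd z) \<le> \<psi> (fst z) r})"
    using min uniq by (fastforce simp: image_iff)
  ultimately show "closed ((\<lambda>p. (p, f p)) ` S)" by simp
qed

text \<open>By strict convexity of the squared norm, two distinct minimisers would be beaten by their
  midpoint.\<close>

lemma convex_proximal_minimiser_unique:
  fixes f :: "'a::real_inner \<Rightarrow> real"
  assumes f: "convex_on K f"
    and q: "q \<in> K" "\<And>r. r \<in> K \<Longrightarrow> f q + (norm (q - p))\<^sup>2 \<le> f r + (norm (r - p))\<^sup>2"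
    and q': "q' \<in> K" "\<And>r. r \<in> K \<Longrightarrow> f q' + (norm (q' - p))\<^sup>2 \<le> f r + (norm (r - p))\<^sup>2"
  shows "q = q'"
proof -
  define m where "m = (1 - 1/2) *\<^sub>R q + (1/2::real) *\<^sub>R q'"
  have "m \<in> K"
    using convex_on_imp_convex[OF f] q(1) q'(1) unfolding m_def by (auto intro: convexD)
  have "f m \<le> f q / 2 + f q' / 2"
    unfolding m_def using convex_onD[OF f, of "1/2" q q'] q(1) q'(1) by simp
  moreover have "(norm (m - p))\<^sup>2 =
      (norm (q - p))\<^sup>2 / 2 + (norm (q' - p))\<^sup>2 / 2 - (norm (q - q'))\<^sup>2 / 4"
    by (simp add: m_def power2_norm_eq_inner algebra_simps inner_commute
        add_divide_distrib diff_divide_distrib)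
  ultimately have "(norm (q - q'))\<^sup>2 \<le> 0"
    using q(2)[OF \<open>m \<in> K\<close>] q'(2)[OF \<open>m \<in> K\<close>] by linarith
  then show "q = q'" by simp
qed

text \<open>A point that minimises a convex function together with a proximal term centred at that very
  point already minimises the function: on the segment towards a competitor the proximal term is of
  second order in the step length, while any decrease of the function would be of first order.\<close>

lemma convex_proximal_fixed_point_imp_minimiser:
  fixes f :: "'a::real_normed_vector \<Rightarrow> real"
  assumes f: "convex_on K f" and "p \<in> K" "q \<in> K"
    and prox: "\<And>r. r \<in> K \<Longrightarrow> f p \<le> f r + (norm (r - p))\<^sup>2"
  shows "f p \<le> f q"
proof -
  have le: "f p \<le> f q + t * (norm (q - p))\<^sup>2" if t: "0 < t" "t \<le> 1" for t
  proof -
    define r where "r = (1 - t) *\<^sub>R p + t *\<^sub>R q"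
    have "r \<in> K"
      using convex_on_imp_convex[OF f] \<open>p \<in> K\<close> \<open>q \<in> K\<close> t unfolding r_def
      by (auto intro: convexD)
    have "r - p = t *\<^sub>R (q - p)" by (simp add: r_def algebra_simps)
    then have "(norm (r - p))\<^sup>2 = t * (t * (norm (q - p))\<^sup>2)"
      by (simp add: power_mult_distrib power2_eq_square)
    moreover have "f r \<le> (1 - t) * f p + t * f q"
      unfolding r_def using convex_onD[OF f] t \<open>p \<in> K\<close> \<open>q \<in> K\<close> by simp
    ultimately have "t * f p \<le> t * (f q + t * (norm (q - p))\<^sup>2)"
      using prox[OF \<open>r \<in> K\<close>] by (simp add: algebra_simps)
    then show ?thesis using t by simp
  qed
  have "((\<lambda>t. f q + t * (norm (q - p))\<^sup>2) \<longlongrightarrow> f q + 0 * (norm (q - p))\<^sup>2) (at_right 0)"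
    by (intro tendsto_intros)
  moreover have "eventually (\<lambda>t. f p \<le> f q + t * (norm (q - p))\<^sup>2) (at_right 0)"
    unfolding eventually_at_right_field using le by (intro exI[of _ 1]) auto
  ultimately have "f p \<le> f q + 0 * (norm (q - p))\<^sup>2"
    by (rule tendsto_lowerbound) simp
  then show ?thesis by simp
qed

text \<open>Brouwer's theorem applies to the map sending \<open>p\<close> to the minimiser over \<open>q\<close> of
  \<open>\<phi>(p, q) + \<parallel>q - p\<parallel>\<^sup>2\<close>. Without the proximal term this best-response map would be set-valued and
  would call for Kakutani's theorem.\<close>

lemma ky_fan_inequality:
  fixes \<phi> :: "'a::euclidean_space \<Rightarrow> 'a \<Rightarrow> real"
  assumes K: "compact K" "K \<noteq> {}" "convex K"
    and cont: "continuous_on (K \<times> K) (\<lambda>(p, q). \<phi> p q)"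
    and conv: "\<And>p. p \<in> K \<Longrightarrow> convex_on K (\<phi> p)"
  obtains p where "p \<in> K" "\<And>q. q \<in> K \<Longrightarrow> \<phi> p p \<le> \<phi> p q"
proof -
  define \<psi> where "\<psi> p q = \<phi> p q + (norm (q - p))\<^sup>2" for p q
  have cont\<psi>: "continuous_on (K \<times> K) (\<lambda>(p, q). \<psi> p q)"
    using cont unfolding \<psi>_def case_prod_unfold by (intro continuous_intros)
  have "\<exists>q\<in>K. \<forall>r\<in>K. \<psi> p q \<le> \<psi> p r" if "p \<in> K" for p
  proof (rule continuous_attains_inf[OF K(1,2)])
    have "continuous_on K (\<lambda>q. (\<lambda>(p, q). \<psi> p q) (p, q))"
      by (rule continuous_on_compose2[OF cont\<psi>]) (use that in \<open>auto intro!: continuous_intros\<close>)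
    then show "continuous_on K (\<psi> p)" by simp
  qed
  then obtain f where f: "\<And>p. p \<in> K \<Longrightarrow> f p \<in> K \<and> (\<forall>r\<in>K. \<psi> p (f p) \<le> \<psi> p r)"
    by metis
  have "q = f p" if "p \<in> K" "q \<in> K" "\<forall>r\<in>K. \<psi> p q \<le> \<psi> p r" for p q
    using convex_proximal_minimiser_unique[OF conv[OF \<open>p \<in> K\<close>], of q p "f p"] that f[OF \<open>p \<in> K\<close>]
    unfolding \<psi>_def by blast
  then have "continuous_on K f"
    using continuous_on_unique_minimiser[OF compact_imp_closed[OF K(1)] K(1) cont\<psi> f] by blast
  then obtain p where p: "p \<in> K" "f p = p"
    using brouwer[OF K(1,3,2), of f] f by blast
  have "\<phi> p p \<le> \<phi> p r + (norm (r - p))\<^sup>2" if "r \<in> K" for r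
    using f[OF p(1)] p(2) that unfolding \<psi>_def by fastforce
  then have "\<phi> p p \<le> \<phi> p q" if "q \<in> K" for q
    using convex_proximal_fixed_point_imp_minimiser[OF conv[OF p(1)] p(1) that] by blast
  then show ?thesis using that p(1) by blast
qed

text \<open>Ky Fan's inequality is used with \<open>\<phi>((x, y), (x', y')) = c(x', y) - c(x, y')\<close>, the total gain from
  both players deviating unilaterally; it vanishes on the diagonal, and letting only one player
  deviate gives the two saddle point inequalities.\<close>

lemma convex_concave_saddle_point:
  fixes c :: "'a::euclidean_space \<times> 'b::euclidean_space \<Rightarrow> real"
  assumes X: "compact X" "X \<noteq> {}" "convex X" and Y: "compact Y" "Y \<noteq> {}" "convex Y"
    and cont: "continuous_on (X \<times> Y) c"
    and conv: "\<And>y. y \<in> Y \<Longrightarrow> convex_on X (\<lambda>x. c (x, y))"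
    and conc: "\<And>x. x \<in> X \<Longrightarrow> concave_on Y (\<lambda>y. c (x, y))"
  obtains x0 y0 where "x0 \<in> X" "y0 \<in> Y"
    "\<And>x. x \<in> X \<Longrightarrow> c (x0, y0) \<le> c (x, y0)"
    "\<And>y. y \<in> Y \<Longrightarrow> c (x0, y) \<le> c (x0, y0)"
proof -
  define \<phi> where "\<phi> p q = c (fst q, snd p) - c (fst p, snd q)" for p q
  have "compact (X \<times> Y)" "X \<times> Y \<noteq> {}" "convex (X \<times> Y)"
    using X Y by (auto intro: compact_Times convex_Times)
  moreover have "continuous_on ((X \<times> Y) \<times> (X \<times> Y)) (\<lambda>(p, q). \<phi> p q)"
    unfolding \<phi>_def case_prod_unfold
    by (intro continuous_intros continuous_on_compose2[OF cont]) auto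
  moreover have "convex_on (X \<times> Y) (\<phi> p)" if p: "p \<in> X \<times> Y" for p
  proof -
    have "convex_on X (\<lambda>x. c (x, snd p))" and "convex_on Y (\<lambda>y. - c (fst p, y))"
      using conv[of "snd p"] conc[of "fst p"] p by (auto simp: concave_on_def)
    then have "\<phi> p (u *\<^sub>R q + v *\<^sub>R r) \<le> u * \<phi> p q + v * \<phi> p r"
      if "q \<in> X \<times> Y" "r \<in> X \<times> Y" "u \<ge> 0" "v \<ge> 0" "u + v = 1" for q r u v
    proof -
      have "c (u *\<^sub>R fst q + v *\<^sub>R fst r, snd p) \<le> u * c (fst q, snd p) + v * c (fst r, snd p)"
        using \<open>convex_on X _\<close> that unfolding convex_on_def by (auto simp: mem_Times_iff)
      moreover have "- c (fst p, u *\<^sub>R snd q + v *\<^sub>R snd r)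
          \<le> u * (- c (fst p, snd q)) + v * (- c (fst p, snd r))"
        using \<open>convex_on Y _\<close> that unfolding convex_on_def mem_Times_iff by blast
      ultimately show ?thesis unfolding \<phi>_def by (simp add: algebra_simps)
    qed
    then show ?thesis
      using \<open>convex (X \<times> Y)\<close> unfolding convex_on_def by blast
  qed
  ultimately obtain p where p: "p \<in> X \<times> Y" "\<And>q. q \<in> X \<times> Y \<Longrightarrow> \<phi> p p \<le> \<phi> p q"
    using ky_fan_inequality[of "X \<times> Y" \<phi>] by blast
  show ?thesis
  proof
    show "fst p \<in> X" "snd p \<in> Y" using p(1) by auto
    show "c (fst p, snd p) \<le> c (x, snd p)" if "x \<in> X" for x
      using p(2)[of "(x, snd p)"] p(1) that by (simp add: \<phi>_def mem_Times_iff)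
    show "c (fst p, y) \<le> c (fst p, snd p)" if "y \<in> Y" for y
      using p(2)[of "(fst p, y)"] p(1) that by (simp add: \<phi>_def mem_Times_iff)
  qed
qed

section \<open>The smoothed step function\<close>

lemma smoothed_step_nonneg:
  assumes "\<And>s. 0 \<le> \<rho> s"
  shows "0 \<le> smoothed_step \<rho> t \<mu>"
proof (cases "\<rho> integrable_on {..t / \<mu>}")
  case True
  then show ?thesis unfolding smoothed_step_def using assms by (intro integral_nonneg) auto
qed (simp add: smoothed_step_def not_integrable_integral)

lemma smoothed_step_eq_0:
  assumes supp: "\<And>s. s < 0 \<Longrightarrow> \<rho> s = 0" and "t \<le> 0" "\<mu> > 0"
  shows "smoothed_step \<rho> t \<mu> = 0"
proof -
  have "t / \<mu> \<le> 0" using assms by (simp add: divide_nonpos_pos)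
  \<comment> \<open>For \<open>t = 0\<close> the density may be nonzero at the endpoint, which is a null set.\<close>
  then have "(\<rho> has_integral 0) {..t / \<mu>}"
    using supp by (intro has_integral_negligible[of "{0}"]) auto
  then show ?thesis by (simp add: smoothed_step_def integral_unique)
qed

lemma smoothed_step_eq_1:
  assumes int: "(\<rho> has_integral 1) UNIV"
    and supp: "\<And>s. s > \<alpha> \<Longrightarrow> \<rho> s = 0" and "\<alpha> * \<mu> \<le> t" "\<mu> > 0"
  shows "smoothed_step \<rho> t \<mu> = 1"
proof -
  have "\<alpha> \<le> t / \<mu>" using assms by (simp add: pos_le_divide_eq)
  then have "(\<lambda>s. if s \<in> {..t / \<mu>} then \<rho> s else 0) = \<rho>"
    using supp by fastforce
  then have "(\<rho> has_integral 1) {..t / \<mu>}"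
    using int has_integral_restrict_UNIV[of "{..t / \<mu>}" \<rho> 1] by simp
  then show ?thesis by (simp add: smoothed_step_def integral_unique)
qed

text \<open>If \<open>u x0 \<le> 0\<close> the left-hand side is zero. If \<open>u x0 > 0\<close>, then for \<open>\<alpha> \<mu> < u x0\<close> the
  smoothing has saturated at one on a whole neighbourhood of \<open>x0\<close>; as \<open>\<mu>\<close> is fixed first, this
  neighbourhood may depend on it.\<close>

lemma smoothed_step_local_min:
  fixes u :: "'a::t2_space \<Rightarrow> real"
  assumes \<rho>: "density_function \<rho>" "\<And>s. s \<notin> {0..\<alpha>} \<Longrightarrow> \<rho> s = 0" and "\<alpha> > 0"
    and u: "isCont u x0"
  shows "\<forall>\<^sub>F \<mu> in at_right 0. \<forall>\<^sub>F x in nhds x0.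
           smoothed_step \<rho> (u x0) \<mu> \<le> smoothed_step \<rho> (u x) \<mu>"
proof (cases "u x0 \<le> 0")
  case True
  have "smoothed_step \<rho> (u x0) \<mu> \<le> smoothed_step \<rho> (u x) \<mu>" if "\<mu> > 0" for \<mu> x
    using smoothed_step_eq_0[of \<rho> "u x0" \<mu>] smoothed_step_nonneg[of \<rho> "u x" \<mu>] \<rho> True that
    by (auto simp: density_function_def)
  then show ?thesis
    using eventually_at_right_less[of "0::real"] by (auto elim!: eventually_mono)
next
  case False
  have one: "smoothed_step \<rho> t \<mu> = 1" if "\<alpha> * \<mu> < t" "\<mu> > 0" for t \<mu>
    using smoothed_step_eq_1[of \<rho> \<alpha> \<mu> t] \<rho> that by (auto simp: density_function_def)
  have "\<forall>\<^sub>F x in nhds x0. smoothed_step \<rho> (u x0) \<mu> \<le> smoothed_step \<rho> (u x) \<mu>"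
    if \<mu>: "0 < \<mu>" "\<mu> < u x0 / \<alpha>" for \<mu>
  proof -
    have less: "\<alpha> * \<mu> < u x0" using \<mu> \<open>\<alpha> > 0\<close> by (simp add: pos_less_divide_eq mult.commute)
    have "(u \<longlongrightarrow> u x0) (nhds x0)"
      using u by (simp add: continuous_at tendsto_at_iff_tendsto_nhds)
    then have "\<forall>\<^sub>F x in nhds x0. \<alpha> * \<mu> < u x"
      using less by (rule order_tendstoD)
    then show ?thesis
      using one less \<mu>(1) by (auto elim!: eventually_mono)
  qed
  moreover have "\<forall>\<^sub>F \<mu> in at_right 0. 0 < \<mu> \<and> \<mu> < u x0 / \<alpha>"
    using False \<open>\<alpha> > 0\<close> unfolding eventually_at_right_field
    by (intro exI[of _ "u x0 / \<alpha>"]) auto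
  ultimately show ?thesis by (auto elim!: eventually_mono)
qed

lemma smoothed_step_sum_local_min:
  fixes g :: "'a::t2_space \<Rightarrow> real^'p"
  assumes "density_function \<rho>" "\<And>s. s \<notin> {0..\<alpha>} \<Longrightarrow> \<rho> s = 0" "\<alpha> > 0" "isCont g x0"
  shows "\<forall>\<^sub>F \<mu> in at_right 0. \<forall>\<^sub>F x in nhds x0.
           (\<Sum>i\<in>UNIV. smoothed_step \<rho> (g x0 $ i) \<mu>) \<le> (\<Sum>i\<in>UNIV. smoothed_step \<rho> (g x $ i) \<mu>)"
proof -
  have "\<forall>\<^sub>F \<mu> in at_right 0. \<forall>\<^sub>F x in nhds x0.
      smoothed_step \<rho> (g x0 $ i) \<mu> \<le> smoothed_step \<rho> (g x $ i) \<mu>" for i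
    using assms by (intro smoothed_step_local_min continuous_intros)
  then have "\<forall>\<^sub>F \<mu> in at_right 0. \<forall>i. \<forall>\<^sub>F x in nhds x0.
      smoothed_step \<rho> (g x0 $ i) \<mu> \<le> smoothed_step \<rho> (g x $ i) \<mu>"
    by (rule eventually_all_finite)
  then show ?thesis
  proof (rule eventually_mono)
    fix \<mu>
    assume "\<forall>i. \<forall>\<^sub>F x in nhds x0. smoothed_step \<rho> (g x0 $ i) \<mu> \<le> smoothed_step \<rho> (g x $ i) \<mu>"
    then have "\<forall>\<^sub>F x in nhds x0. \<forall>i.
        smoothed_step \<rho> (g x0 $ i) \<mu> \<le> smoothed_step \<rho> (g x $ i) \<mu>"
      by (intro eventually_all_finite) blast
    then show "\<forall>\<^sub>F x in nhds x0.
        (\<Sum>i\<in>UNIV. smoothed_step \<rho> (g x0 $ i) \<mu>) \<le> (\<Sum>i\<in>UNIV. smoothed_step \<rho> (g x $ i) \<mu>)"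
      by (rule eventually_mono) (simp add: sum_mono)
  qed
qed

section \<open>Local saddle points of the smoothed problem\<close>

lemma local_saddle_pointI_eventually:
  assumes "xs \<in> X" "ys \<in> Y"
    and "\<forall>\<^sub>F x in nhds xs. x \<in> X \<longrightarrow> F xs ys \<le> F x ys"
    and "\<forall>\<^sub>F y in nhds ys. y \<in> Y \<longrightarrow> F xs y \<le> F xs ys"
  shows "local_saddle_point X Y F xs ys"
proof -
  obtain d1 d2 where d: "d1 > 0" "d2 > 0"
    "\<And>x. dist x xs < d1 \<Longrightarrow> x \<in> X \<Longrightarrow> F xs ys \<le> F x ys"
    "\<And>y. dist y ys < d2 \<Longrightarrow> y \<in> Y \<Longrightarrow> F xs y \<le> F xs ys"
    using assms(3,4) unfolding eventually_nhds_metric by blast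
  \<comment> \<open>Halving turns the open balls into closed ones.\<close>
  define e where "e = min d1 d2 / 2"
  have "e > 0" "e < d1" "e < d2" using d(1,2) by (auto simp: e_def min_def)
  then show ?thesis
    unfolding local_saddle_point_def using assms(1,2) d(3,4)
    by (intro conjI exI[of _ e]) (auto simp: dist_commute)
qed

lemma continuously_differentiable_imp_isCont:
  assumes "continuously_differentiable f"
  shows "isCont f x"
  using assms has_derivative_continuous unfolding continuously_differentiable_def by blast

theorem proposition3p1:
  fixes c :: "(real^'n) \<times> (real^'m) \<Rightarrow> real"
    and g :: "real^'n \<Rightarrow> real^'p"
    and h :: "real^'m \<Rightarrow> real^'q"
    and X :: "(real^'n) set" and Y :: "(real^'m) set"
    and l1 l2 \<alpha> :: real
    and \<rho> :: "real \<Rightarrow> real"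
  assumes "\<exists>L. L-lipschitz_on UNIV c"
    and "\<And>y. convex_on UNIV (\<lambda>x. c (x, y))"
    and "\<And>x. concave_on UNIV (\<lambda>y. c (x, y))"
    and "continuously_differentiable g"
    and "continuously_differentiable h"
    and "X \<noteq> {}" and "convex X" and "compact X"
    and "Y \<noteq> {}" and "convex Y" and "compact Y"
    and "l1 > 0" and "l2 > 0"
    and "\<alpha> > 0"
    and "piecewise_continuous \<rho>"
    and "density_function \<rho>"
    and "\<And>s. s \<notin> {0..\<alpha>} \<Longrightarrow> \<rho> s = 0"
  shows "\<exists>\<mu>t>0. \<forall>\<mu>. 0 < \<mu> \<and> \<mu> < \<mu>t \<longrightarrow>
           (\<exists>xs ys. local_saddle_point X Y (\<lambda>x y. fR c g h l1 l2 \<rho> x y \<mu>) xs ys)"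
proof -
  have "continuous_on (X \<times> Y) c"
    using assms(1) lipschitz_on_continuous_on continuous_on_subset by blast
  moreover have "convex_on X (\<lambda>x. c (x, y))" for y
    using convex_on_subset[OF assms(2)] \<open>convex X\<close> by simp
  moreover have "concave_on Y (\<lambda>y. c (x, y))" for x
    using assms(3) convex_on_subset \<open>convex Y\<close> unfolding concave_on_def by blast
  ultimately obtain x0 y0 where xy: "x0 \<in> X" "y0 \<in> Y"
    and cx: "\<And>x. x \<in> X \<Longrightarrow> c (x0, y0) \<le> c (x, y0)"
    and cy: "\<And>y. y \<in> Y \<Longrightarrow> c (x0, y) \<le> c (x0, y0)"
    using convex_concave_saddle_point[of X Y c] assms(6-11) by blast
  have step_g: "\<forall>\<^sub>F \<mu> in at_right 0. \<forall>\<^sub>F x in nhds x0.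
      (\<Sum>i\<in>UNIV. smoothed_step \<rho> (g x0 $ i) \<mu>) \<le> (\<Sum>i\<in>UNIV. smoothed_step \<rho> (g x $ i) \<mu>)"
    by (rule smoothed_step_sum_local_min[of \<rho> \<alpha>])
      (use assms continuously_differentiable_imp_isCont[OF assms(4)] in auto)
  have step_h: "\<forall>\<^sub>F \<mu> in at_right 0. \<forall>\<^sub>F y in nhds y0.
      (\<Sum>j\<in>UNIV. smoothed_step \<rho> (h y0 $ j) \<mu>) \<le> (\<Sum>j\<in>UNIV. smoothed_step \<rho> (h y $ j) \<mu>)"
    by (rule smoothed_step_sum_local_min[of \<rho> \<alpha>])
      (use assms continuously_differentiable_imp_isCont[OF assms(5)] in auto)
  define F where "F \<mu> = (\<lambda>x y. fR c g h l1 l2 \<rho> x y \<mu>)" for \<mu>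
  have "\<forall>\<^sub>F \<mu> in at_right 0. local_saddle_point X Y (F \<mu>) x0 y0"
    using step_g step_h
  proof eventually_elim
    case (elim \<mu>)
    show ?case
    proof (rule local_saddle_pointI_eventually[OF xy])
      show "\<forall>\<^sub>F x in nhds x0. x \<in> X \<longrightarrow> F \<mu> x0 y0 \<le> F \<mu> x y0"
        using elim(1)
        by eventually_elim (use cx \<open>l1 > 0\<close> in \<open>auto simp: F_def fR_def intro!: add_mono mult_left_mono\<close>)
      show "\<forall>\<^sub>F y in nhds y0. y \<in> Y \<longrightarrow> F \<mu> x0 y \<le> F \<mu> x0 y0"
        using elim(2)
        by eventually_elim (use cy \<open>l2 > 0\<close> in \<open>auto simp: F_def fR_def intro!: diff_mono mult_left_mono\<close>)
    qed
  qed
  then show ?thesis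
    unfolding eventually_at_right_field F_def by blast
qed

end
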